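(* Let $G$ be a finite group and $\mathcal{O}$ a disklike $G$-transfer system. Let $N=N_{\mathcal{O}}$ be the minimal subgroup of $G$ that transfers to $G$ in $\mathcal{O}$ (it is normal in $G$), let $Q=G/N$, let $p\colon G\to Q$ be the quotient map, and let $\mathcal{O}'=\mathcal{O}^N$. Then $\mathcal{O}'$ is a disklike $Q$-transfer system containing the transfer $1\to Q$, and the computation of $\mathrm{M}(\mathcal{O})$ reduces to that of $\mathrm{M}(\mathcal{O}')$ via $$\mathrm{M}(\mathcal{O})=\mathrm{Res}\big(p^{-1}\mathrm{M}(\mathcal{O}')\big).$$
   Context: For a finite group $G$, a $G$-transfer system $\mathcal{O}$ is a binary relation $\to$ on the set of subgroups of $G$, refining inclusion ($K\to H$ implies $K\le H$), such that: $H\to H$ for all $H\le G$; $K\to H$ implies $gKg^{-1}\to gHg^{-1}$ for all $g\in G$; $K\to H$ and $L\le H$ imply $K\cap L\to L$; and $L\to K$, $K\to H$ imply $L\to H$. Its elements are called transfers. $\mathcal{O}$ is disklike if it is generated by transfers with target $G$, i.e. it is the smallest $G$-transfer system containing some set of pairs of the form $H\to G$. A pair $(\mathcal{O}_a,\mathcal{O}_m)$ of $G$-transfer systems is compatible if $\mathcal{O}_m\subseteq\mathcal{O}_a$ and, for all $K,J\le H\le G$, if $K\to H$ is in $\mathcal{O}_m$ and $K\cap J\to K$ is in $\mathcal{O}_a$, then $J\to H$ is in $\mathcal{O}_a$. $\mathrm{M}(\mathcal{O})$ denotes the unique largest (under containment) $G$-transfer system such that $(\mathcal{O},\mathrm{M}(\mathcal{O}))$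 is compatible. The subgroups $H$ with $H\to G$ in $\mathcal{O}$ are closed under intersection, so there is a smallest one, denoted $N_{\mathcal{O}}$. For $N\trianglelefteq G$ with projection $p\colon G\to G/N$: $\mathcal{O}^N$ is the $G/N$-transfer system obtained by restricting $\mathcal{O}$ to the subgroups of $G$ containing $N$, identified with the subgroups of $G/N$ (so $H/N\to K/N$ is in $\mathcal{O}^N$ iff $H\to K$ is in $\mathcal{O}$). For a $G/N$-transfer system $\mathcal{P}$, $p^{-1}\mathcal{P}=\{p^{-1}K\to p^{-1}H\mid K\to H\text{ in }\mathcal{P}\}$. For a binary relation $B$ on subgroups of $G$ refining inclusion, $\mathrm{Res}(B)=\bigcup_{K\to H\in B}\{L\cap K\to L\mid L\le H\}$. *)

theory Defs
  imports "HOL-Algebra.Coset"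
begin

text \<open>
  A binary relation on the subgroups of \<open>G\<close> is a set of pairs of carriers;
  \<open>(K, H)\<close> stands for the transfer \<open>K \<rightarrow> H\<close>.
\<close>

definition transfer_system ::
    "('a, 'b) monoid_scheme \<Rightarrow> ('a set \<times> 'a set) set \<Rightarrow> bool" where
  "transfer_system G \<O> \<longleftrightarrow>
     (\<forall>K H. (K, H) \<in> \<O> \<longrightarrow> subgroup K G \<and> subgroup H G \<and> K \<subseteq> H) \<and>
     (\<forall>H. subgroup H G \<longrightarrow> (H, H) \<in> \<O>) \<and>
     (\<forall>K H. \<forall>g\<in>carrier G. (K, H) \<in> \<O> \<longrightarrow>
        (g <#\<^bsub>G\<^esub> K #>\<^bsub>G\<^esub> inv\<^bsub>G\<^esub> g, g <#\<^bsub>G\<^esub> H #>\<^bsub>G\<^esub> inv\<^bsub>G\<^esub> g) \<in> \<O>) \<and>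
     (\<forall>K H L. (K, H) \<in> \<O> \<and> subgroup L G \<and> L \<subseteq> H \<longrightarrow> (K \<inter> L, L) \<in> \<O>) \<and>
     (\<forall>L K H. (L, K) \<in> \<O> \<and> (K, H) \<in> \<O> \<longrightarrow> (L, H) \<in> \<O>)"

definition disklike ::
    "('a, 'b) monoid_scheme \<Rightarrow> ('a set \<times> 'a set) set \<Rightarrow> bool" where
  "disklike G \<O> \<longleftrightarrow>
     (\<exists>S \<subseteq> {(H, carrier G) |H. subgroup H G}.
        transfer_system G \<O> \<and> S \<subseteq> \<O> \<and>
        (\<forall>\<T>. transfer_system G \<T> \<and> S \<subseteq> \<T> \<longrightarrow> \<O> \<subseteq> \<T>))"

definition compatible ::
    "('a, 'b) monoid_scheme \<Rightarrow> ('a set \<times> 'a set) set \<Rightarrow> ('a set \<times> 'a set) set \<Rightarrow> bool" where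
  "compatible G \<O>\<^sub>a \<O>\<^sub>m \<longleftrightarrow>
     transfer_system G \<O>\<^sub>a \<and> transfer_system G \<O>\<^sub>m \<and> \<O>\<^sub>m \<subseteq> \<O>\<^sub>a \<and>
     (\<forall>K J H. subgroup K G \<and> subgroup J G \<and> subgroup H G \<and> K \<subseteq> H \<and> J \<subseteq> H \<and>
        (K, H) \<in> \<O>\<^sub>m \<and> (K \<inter> J, K) \<in> \<O>\<^sub>a \<longrightarrow> (J, H) \<in> \<O>\<^sub>a)"

text \<open>
  The library operators \<open>Greatest\<close> and \<open>Least\<close> below are taken with respect to inclusion.
  The lemmas \<open>compatible_max_multiplicative\<close> and \<open>min_transfer_Least\<close> show that the extremal
  elements exist.
\<close>

definition max_multiplicative ::
    "('a, 'b) monoid_scheme \<Rightarrow> ('a set \<times> 'a set) set \<Rightarrow> ('a set \<times> 'a set) set" where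
  "max_multiplicative G \<O> = (GREATEST \<M>. compatible G \<O> \<M>)"

definition min_transfer ::
    "('a, 'b) monoid_scheme \<Rightarrow> ('a set \<times> 'a set) set \<Rightarrow> 'a set" where
  "min_transfer G \<O> = (LEAST H. (H, carrier G) \<in> \<O>)"

definition quotient_map :: "('a, 'b) monoid_scheme \<Rightarrow> 'a set \<Rightarrow> 'a \<Rightarrow> 'a set" where
  "quotient_map G N = (\<lambda>x. N #>\<^bsub>G\<^esub> x)"

text \<open>
  For \<open>N \<subseteq> H\<close>, the subgroup \<open>H/N\<close> of \<open>G Mod N\<close> is the image of \<open>H\<close> under the quotient map.
\<close>

definition quotient_system ::
    "('a, 'b) monoid_scheme \<Rightarrow> 'a set \<Rightarrow> ('a set \<times> 'a set) set \<Rightarrow> ('a set set \<times> 'a set set) set"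
  where
  "quotient_system G N \<O> =
     {(quotient_map G N ` H, quotient_map G N ` K) |H K. (H, K) \<in> \<O> \<and> N \<subseteq> H \<and> N \<subseteq> K}"

definition preimage_system ::
    "('a, 'b) monoid_scheme \<Rightarrow> ('a \<Rightarrow> 'c) \<Rightarrow> ('c set \<times> 'c set) set \<Rightarrow> ('a set \<times> 'a set) set"
  where
  "preimage_system G p \<P> =
     {({x \<in> carrier G. p x \<in> K}, {x \<in> carrier G. p x \<in> H}) |K H. (K, H) \<in> \<P>}"

definition Res ::
    "('a, 'b) monoid_scheme \<Rightarrow> ('a set \<times> 'a set) set \<Rightarrow> ('a set \<times> 'a set) set" where
  "Res G B = (\<Union>(K, H)\<in>B. {(L \<inter> K, L) |L. subgroup L G \<and> L \<subseteq> H})"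

lemma transfer_systemD:
  assumes "transfer_system G \<O>"
  shows "(K, H) \<in> \<O> \<Longrightarrow> subgroup K G \<and> subgroup H G \<and> K \<subseteq> H"
    and "subgroup H G \<Longrightarrow> (H, H) \<in> \<O>"
    and "(K, H) \<in> \<O> \<Longrightarrow> g \<in> carrier G \<Longrightarrow>
      (g <#\<^bsub>G\<^esub> K #>\<^bsub>G\<^esub> inv\<^bsub>G\<^esub> g, g <#\<^bsub>G\<^esub> H #>\<^bsub>G\<^esub> inv\<^bsub>G\<^esub> g) \<in> \<O>"
    and "(K, H) \<in> \<O> \<Longrightarrow> subgroup L G \<Longrightarrow> L \<subseteq> H \<Longrightarrow> (K \<inter> L, L) \<in> \<O>"
    and "(L, K) \<in> \<O> \<Longrightarrow> (K, H) \<in> \<O> \<Longrightarrow> (L, H) \<in> \<O>"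
proof -
  note D = assms[unfolded transfer_system_def]
  note D1 = D[THEN conjunct1]
  note D2 = D[THEN conjunct2, THEN conjunct1]
  note D3 = D[THEN conjunct2, THEN conjunct2, THEN conjunct1]
  note D4 = D[THEN conjunct2, THEN conjunct2, THEN conjunct2, THEN conjunct1]
  note D5 = D[THEN conjunct2, THEN conjunct2, THEN conjunct2, THEN conjunct2]
  show "(K, H) \<in> \<O> \<Longrightarrow> subgroup K G \<and> subgroup H G \<and> K \<subseteq> H"
    by (rule D1[rule_format])
  show "subgroup H G \<Longrightarrow> (H, H) \<in> \<O>"
    by (rule D2[rule_format])
  show "(K, H) \<in> \<O> \<Longrightarrow> g \<in> carrier G \<Longrightarrow>
      (g <#\<^bsub>G\<^esub> K #>\<^bsub>G\<^esub> inv\<^bsub>G\<^esub> g, g <#\<^bsub>G\<^esub> H #>\<^bsub>G\<^esub> inv\<^bsub>G\<^esub> g) \<in> \<O>"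
    by (rule D3[rule_format])
  show "(K, H) \<in> \<O> \<Longrightarrow> subgroup L G \<Longrightarrow> L \<subseteq> H \<Longrightarrow> (K \<inter> L, L) \<in> \<O>"
    by (rule D4[rule_format]) simp
  show "(L, K) \<in> \<O> \<Longrightarrow> (K, H) \<in> \<O> \<Longrightarrow> (L, H) \<in> \<O>"
    by (rule D5[rule_format]) (rule conjI)
qed

lemma transfer_systemI:
  assumes "\<And>K H. (K, H) \<in> \<O> \<Longrightarrow> subgroup K G \<and> subgroup H G \<and> K \<subseteq> H"
    and "\<And>H. subgroup H G \<Longrightarrow> (H, H) \<in> \<O>"
    and "\<And>K H g. (K, H) \<in> \<O> \<Longrightarrow> g \<in> carrier G \<Longrightarrow>
      (g <#\<^bsub>G\<^esub> K #>\<^bsub>G\<^esub> inv\<^bsub>G\<^esub> g, g <#\<^bsub>G\<^esub> H #>\<^bsub>G\<^esub> inv\<^bsub>G\<^esub> g) \<in> \<O>"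
    and "\<And>K H L. (K, H) \<in> \<O> \<Longrightarrow> subgroup L G \<Longrightarrow> L \<subseteq> H \<Longrightarrow> (K \<inter> L, L) \<in> \<O>"
    and "\<And>L K H. (L, K) \<in> \<O> \<Longrightarrow> (K, H) \<in> \<O> \<Longrightarrow> (L, H) \<in> \<O>"
  shows "transfer_system G \<O>"
  unfolding transfer_system_def
  by (intro conjI allI impI ballI; (elim conjE)?)
    ((drule assms(1), simp)+, rule assms(2), assumption, rule assms(3), assumption, assumption,
      rule assms(4), assumption, assumption, assumption, rule assms(5), assumption, assumption)

lemma compatible_Id:
  assumes "group G" "transfer_system G \<O>"
  shows "compatible G \<O> {(H, H) |H. subgroup H G}"
proof -
  interpret group G by fact
  have conj: "subgroup (g <#\<^bsub>G\<^esub> H #>\<^bsub>G\<^esub> inv\<^bsub>G\<^esub> g) G"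
    if "subgroup H G" "g \<in> carrier G" for g H
    using transfer_systemD(1,3)[OF assms(2)] transfer_systemD(2)[OF assms(2) that(1)] that
    by blast
  have "transfer_system G {(H, H) |H. subgroup H G}"
    unfolding transfer_system_def using conj by (auto simp: Int_absorb1)
  then show ?thesis
    unfolding compatible_def using assms(2) transfer_systemD(2)[OF assms(2)]
    by (auto simp: Int_absorb1)
qed

lemma compatible_trancl_Union:
  assumes "group G" "transfer_system G \<O>"
  shows "compatible G \<O> ((\<Union>{\<M>. compatible G \<O> \<M>})\<^sup>+)"
proof -
  interpret group G by fact
  define U where "U = \<Union>{\<M>. compatible G \<O> \<M>}"
  note TO = transfer_systemD[OF assms(2)]
  have U0: "\<exists>\<M>. compatible G \<O> \<M> \<and> transfer_system G \<M> \<and> (K, H) \<in> \<M>" if "(K, H) \<in> U" for K H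
  proof -
    from that obtain \<M> where "compatible G \<O> \<M>" "(K, H) \<in> \<M>"
      unfolding U_def by blast
    moreover from this have "transfer_system G \<M>"
      unfolding compatible_def by simp
    ultimately show ?thesis by blast
  qed
  have UI: "(K, H) \<in> U" if "compatible G \<O> \<M>" "(K, H) \<in> \<M>" for K H \<M>
    using that unfolding U_def by blast
  have U1: "subgroup K G \<and> subgroup H G \<and> K \<subseteq> H \<and> (K, H) \<in> \<O>" if "(K, H) \<in> U" for K H
  proof -
    from U0[OF that] obtain \<M> where "compatible G \<O> \<M>" "(K, H) \<in> \<M>"
      by blast
    then have "(K, H) \<in> \<O>"
      unfolding compatible_def by auto
    then show ?thesis using TO(1) by simp
  qed
  have U2: "(H, H) \<in> U" if "subgroup H G" for H
    using UI[OF compatible_Id[OF assms]] that by blast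
  have U3: "(g <#\<^bsub>G\<^esub> K #>\<^bsub>G\<^esub> inv\<^bsub>G\<^esub> g, g <#\<^bsub>G\<^esub> H #>\<^bsub>G\<^esub> inv\<^bsub>G\<^esub> g) \<in> U"
    if "(K, H) \<in> U" "g \<in> carrier G" for K H g
  proof -
    from U0[OF that(1)] obtain \<M> where
      M: "compatible G \<O> \<M>" "transfer_system G \<M>" "(K, H) \<in> \<M>"
      by blast
    show ?thesis by (rule UI[OF M(1) transfer_systemD(3)[OF M(2,3) that(2)]])
  qed
  have U4: "(K \<inter> L, L) \<in> U" if "(K, H) \<in> U" "subgroup L G" "L \<subseteq> H" for K H L
  proof -
    from U0[OF that(1)] obtain \<M> where
      M: "compatible G \<O> \<M>" "transfer_system G \<M>" "(K, H) \<in> \<M>"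
      by blast
    show ?thesis by (rule UI[OF M(1) transfer_systemD(4)[OF M(2,3) that(2,3)]])
  qed
  have U5: "(J, H) \<in> \<O>"
    if "(K, H) \<in> U" "subgroup J G" "J \<subseteq> H" "(K \<inter> J, K) \<in> \<O>" for K H J
  proof -
    from U0[OF that(1)] obtain \<M> where M: "compatible G \<O> \<M>" "(K, H) \<in> \<M>"
      by blast
    note D = M(1)[unfolded compatible_def, THEN conjunct2, THEN conjunct2, THEN conjunct2, rule_format]
    show ?thesis
      by (rule D[of K J H]) (simp add: M(2) that(2-) U1[OF that(1)])
  qed
  have V1: "subgroup K G \<and> subgroup H G \<and> K \<subseteq> H \<and> (K, H) \<in> \<O>" if "(K, H) \<in> U\<^sup>+" for K H
    using that
  proof (induction rule: trancl_induct)
    case (base H)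
    then show ?case using U1 by simp
  next
    case (step M H)
    then show ?case using U1[OF step.hyps(2)] TO(5)[of K M H] by (elim conjE) simp
  qed
  have V3: "(g <#\<^bsub>G\<^esub> K #>\<^bsub>G\<^esub> inv\<^bsub>G\<^esub> g, g <#\<^bsub>G\<^esub> H #>\<^bsub>G\<^esub> inv\<^bsub>G\<^esub> g) \<in> U\<^sup>+"
    if "(K, H) \<in> U\<^sup>+" "g \<in> carrier G" for K H g
    using that(1)
  proof (induction rule: trancl_induct)
    case (base H)
    show ?case by (rule r_into_trancl[OF U3[OF base that(2)]])
  next
    case (step M H)
    show ?case by (rule trancl_into_trancl[OF step.IH U3[OF step.hyps(2) that(2)]])
  qed
  have V4: "(K \<inter> L, L) \<in> U\<^sup>+" if "(K, H) \<in> U\<^sup>+" "subgroup L G" "L \<subseteq> H" for K H L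
    using that
  proof (induction arbitrary: L rule: trancl_induct)
    case (base H)
    show ?case by (rule r_into_trancl[OF U4[OF base]])
  next
    case (step M H)
    have M: "subgroup (M \<inter> L) G"
      using U1[OF step.hyps(2)] step.prems(1) by (simp add: subgroups_Inter_pair)
    have "(K \<inter> (M \<inter> L), M \<inter> L) \<in> U\<^sup>+"
      by (rule step.IH[OF M]) simp
    moreover have "K \<inter> (M \<inter> L) = K \<inter> L"
      using V1[OF step.hyps(1)] by blast
    moreover have "(M \<inter> L, L) \<in> U"
      by (rule U4[OF step.hyps(2) step.prems])
    ultimately show ?case
      using trancl_into_trancl[of "K \<inter> L" "M \<inter> L" U L] by simp
  qed
  have V5: "(J, H) \<in> \<O>"
    if "(K, H) \<in> U\<^sup>+" "subgroup J G" "J \<subseteq> H" "(K \<inter> J, K) \<in> \<O>" for K H J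
    using that
  proof (induction arbitrary: J rule: trancl_induct)
    case (base H)
    show ?case by (rule U5[OF base])
  next
    case (step M H)
    have M: "subgroup (M \<inter> J) G"
      using U1[OF step.hyps(2)] step.prems(1) by (simp add: subgroups_Inter_pair)
    have "K \<inter> (M \<inter> J) = K \<inter> J"
      using V1[OF step.hyps(1)] by blast
    then have "(M \<inter> J, M) \<in> \<O>"
      using step.IH[OF M] step.prems(3) U1[OF step.hyps(2)]
      by (simp add: Int_commute)
    then show ?case
      by (rule U5[OF step.hyps(2) step.prems(1,2)])
  qed
  have "transfer_system G (U\<^sup>+)"
  proof (rule transfer_systemI)
    show "subgroup K G \<and> subgroup H G \<and> K \<subseteq> H" if "(K, H) \<in> U\<^sup>+" for K H
      using V1[OF that] by simp
    show "(H, H) \<in> U\<^sup>+" if "subgroup H G" for H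
      by (rule r_into_trancl[OF U2[OF that]])
  qed (fact V3 V4 trancl_trans)+
  then have "compatible G \<O> (U\<^sup>+)"
    unfolding compatible_def
  proof (intro conjI allI impI subrelI)
    show "(K, H) \<in> \<O>" if "(K, H) \<in> U\<^sup>+" for K H
      using V1[OF that] by simp
    show "(J, H) \<in> \<O>"
      if "subgroup K G \<and> subgroup J G \<and> subgroup H G \<and> K \<subseteq> H \<and> J \<subseteq> H \<and>
        (K, H) \<in> U\<^sup>+ \<and> (K \<inter> J, K) \<in> \<O>" for K J H
      using V5[of K H J] that by (elim conjE)
  qed (use assms(2) in assumption)+
  then show ?thesis
    unfolding U_def .
qed

lemma compatible_max_multiplicative:
  assumes "group G" "transfer_system G \<O>"
  shows "compatible G \<O> (max_multiplicative G \<O>)"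
    and "compatible G \<O> \<M> \<Longrightarrow> \<M> \<subseteq> max_multiplicative G \<O>"
proof -
  let ?V = "(\<Union>{\<M>. compatible G \<O> \<M>})\<^sup>+"
  have le: "\<M> \<subseteq> ?V" if "compatible G \<O> \<M>" for \<M>
    using that by (auto intro: r_into_trancl')
  have eq: "max_multiplicative G \<O> = ?V"
    unfolding max_multiplicative_def
    by (rule Greatest_equality) (use compatible_trancl_Union[OF assms] le in auto)
  show "compatible G \<O> (max_multiplicative G \<O>)"
    unfolding eq by (rule compatible_trancl_Union[OF assms])
  show "\<M> \<subseteq> max_multiplicative G \<O>" if "compatible G \<O> \<M>"
    unfolding eq by (rule le[OF that])
qed

lemma min_transfer_Least:
  assumes "group G" "finite (carrier G)" "transfer_system G \<O>"
  shows "(min_transfer G \<O>, carrier G) \<in> \<O>"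
    and "(H, carrier G) \<in> \<O> \<Longrightarrow> min_transfer G \<O> \<subseteq> H"
proof -
  interpret group G by fact
  note TO = transfer_systemD[OF assms(3)]
  let ?S = "{H. (H, carrier G) \<in> \<O>}"
  have sub: "?S \<subseteq> Pow (carrier G)"
    using TO(1) by blast
  have fin: "finite ?S"
    using finite_subset[OF sub] assms(2) by simp
  have ne: "?S \<noteq> {}"
    using TO(2)[OF subgroup_self] by blast
  have Int: "H \<inter> K \<in> ?S" if "H \<in> ?S" "K \<in> ?S" for H K
    using that TO(1)[of K "carrier G"] TO(4)[of H "carrier G" K] TO(5)[of "H \<inter> K" K "carrier G"]
    by blast
  have "\<Inter>F \<in> ?S" if "finite F" "F \<noteq> {}" "F \<subseteq> ?S" for F
    using that
  proof (induction rule: finite_ne_induct)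
    case (insert H F)
    then show ?case
      using Int[of H "\<Inter>F"] by simp
  qed simp
  from this[OF fin ne] have mem: "\<Inter>?S \<in> ?S" by blast
  have eq: "min_transfer G \<O> = \<Inter>?S"
    unfolding min_transfer_def by (rule Least_equality) (use mem in blast)+
  show "(min_transfer G \<O>, carrier G) \<in> \<O>"
    using mem unfolding eq by blast
  show "(H, carrier G) \<in> \<O> \<Longrightarrow> min_transfer G \<O> \<subseteq> H"
    unfolding eq by blast
qed

end

theory Submission
  imports Defs "HOL-Algebra.Group_Action"
begin

text \<open>
  Both sides of the formula become explicit once two descriptions are available.

  First, a disklike system consists of the restrictions of its transfers to \<open>G\<close>: those
  restrictions already form a transfer system, since a composite of two of them is the restriction
  of the intersection of two subgroups that transfer to \<open>G\<close> (\<open>disklike_iff\<close>). All these subgroups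
  contain \<open>N\<close>, so every transfer \<open>A \<rightarrow> C\<close> of \<open>\<O>\<close> satisfies \<open>C \<inter> N \<subseteq> A\<close>, and it is recovered from
  the transfer \<open>AN/N \<rightarrow> CN/N\<close> of \<open>\<O>'\<close>. In other words \<open>\<O> = Res (p\<^sup>-\<^sup>1 \<O>')\<close>
  (\<open>Res_preimage_image_system\<close>), and what remains is that \<open>M\<close> commutes with the operation
  \<open>\<P> \<mapsto> Res (p\<^sup>-\<^sup>1 \<P>)\<close> (\<open>max_multiplicative_Res_preimage\<close>).

  Second, \<open>M(\<O>)\<close> contains \<open>K \<rightarrow> H\<close> exactly when, for all \<open>J \<le> L \<le> H\<close>, a transfer
  \<open>K \<inter> J \<rightarrow> K \<inter> L\<close> in \<open>\<O>\<close> forces \<open>J \<rightarrow> L\<close> in \<open>\<O>\<close> (\<open>max_multiplicative_eq\<close>). This criterion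
  mentions no other multiplicative transfer, so it can be compared upstairs and downstairs one pair
  at a time. The comparison uses \<open>Res_preimage_iff\<close>: a pair \<open>A \<le> C\<close> lies in \<open>Res (p\<^sup>-\<^sup>1 \<P>)\<close> iff
  \<open>C \<inter> N \<subseteq> A\<close> and \<open>p A \<rightarrow> p C\<close> is in \<open>\<P>\<close>. The first condition says that \<open>A\<close> is a union of
  fibres of \<open>p\<close> restricted to \<open>C\<close>, which makes \<open>p\<close> commute with intersections by \<open>A\<close> inside \<open>C\<close>.
\<close>

section \<open>Conjugation\<close>

context group
begin

lemma conjugate_eq_image: "g <# K #> inv g = (\<lambda>x. g \<otimes> x \<otimes> inv g) ` K"
  by (auto simp: l_coset_def r_coset_def)

lemma inj_on_conjugation:
  assumes "g \<in> carrier G"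
  shows "inj_on (\<lambda>x. g \<otimes> x \<otimes> inv g) (carrier G)"
  using assms by (auto intro!: inj_onI)

lemma conjugate_Int:
  assumes "g \<in> carrier G" "A \<subseteq> carrier G" "B \<subseteq> carrier G"
  shows "g <# (A \<inter> B) #> inv g = (g <# A #> inv g) \<inter> (g <# B #> inv g)"
  unfolding conjugate_eq_image
  by (rule inj_on_image_Int[OF inj_on_conjugation]) (use assms in auto)

lemma conjugate_inv_cancel:
  assumes "g \<in> carrier G" "A \<subseteq> carrier G"
  shows "inv g <# (g <# A #> inv g) #> inv (inv g) = A"
    and "g <# (inv g <# A #> inv (inv g)) #> inv g = A"
proof -
  have "inv g \<otimes> (g \<otimes> x \<otimes> inv g) \<otimes> inv (inv g) = x"
    "g \<otimes> (inv g \<otimes> x \<otimes> inv (inv g)) \<otimes> inv g = x" if "x \<in> A" for x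
    using assms that by (auto simp: m_assoc subset_iff) (simp add: m_assoc[symmetric])+
  then show "inv g <# (g <# A #> inv g) #> inv (inv g) = A"
    and "g <# (inv g <# A #> inv (inv g)) #> inv g = A"
    unfolding conjugate_eq_image image_image by auto
qed

lemma conjugate_mono: "A \<subseteq> B \<Longrightarrow> g <# A #> inv g \<subseteq> g <# B #> inv g"
  unfolding conjugate_eq_image by blast

lemma conjugate_carrier:
  assumes "g \<in> carrier G"
  shows "g <# carrier G #> inv g = carrier G"
proof
  have sub: "h <# carrier G #> inv h \<subseteq> carrier G" if "h \<in> carrier G" for h
    using that by (auto simp: conjugate_eq_image)
  show "g <# carrier G #> inv g \<subseteq> carrier G"
    by (rule sub[OF assms])
  from conjugate_mono[OF sub[of "inv g"], of g]
  show "carrier G \<subseteq> g <# carrier G #> inv g"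
    using conjugate_inv_cancel(2)[OF assms, of "carrier G"] assms by (simp del: inv_inv)
qed

end

section \<open>Disklike transfer systems\<close>

text \<open>
  The restrictions of transfers to \<open>G\<close> are closed under composition because the sources of those
  transfers are closed under intersection; hence they already exhaust the generated system.
\<close>

lemma (in group) disklike_iff:
  "disklike G \<O> \<longleftrightarrow> transfer_system G \<O> \<and>
    (\<forall>A C. (A, C) \<in> \<O> \<longrightarrow> (\<exists>K. (K, carrier G) \<in> \<O> \<and> A = K \<inter> C))"
proof (intro iffI conjI)
  assume "disklike G \<O>"
  then obtain S where "S \<subseteq> {(H, carrier G) |H. subgroup H G} \<and> transfer_system G \<O> \<and>
    S \<subseteq> \<O> \<and> (\<forall>\<T>. transfer_system G \<T> \<and> S \<subseteq> \<T> \<longrightarrow> \<O> \<subseteq> \<T>)"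
    unfolding disklike_def by (rule exE)
  then have S: "S \<subseteq> {(H, carrier G) |H. subgroup H G}" "S \<subseteq> \<O>"
    and ts: "transfer_system G \<O>"
    and least: "\<And>\<T>. transfer_system G \<T> \<Longrightarrow> S \<subseteq> \<T> \<Longrightarrow> \<O> \<subseteq> \<T>"
    by simp_all
  note T = transfer_systemD[OF ts]
  define R where "R = {(K \<inter> L, L) |K L. (K, carrier G) \<in> \<O> \<and> subgroup L G}"
  have RI: "(A, L) \<in> R" if "(K, carrier G) \<in> \<O>" "subgroup L G" "A = K \<inter> L" for K L A
    using that unfolding R_def by blast
  have RE: "\<exists>K. (K, carrier G) \<in> \<O> \<and> subgroup L G \<and> subgroup K G \<and> A = K \<inter> L"
    if "(A, L) \<in> R" for A L
  proof -
    from that obtain K where "(K, carrier G) \<in> \<O>" "subgroup L G" "A = K \<inter> L"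
      unfolding R_def by blast
    then show ?thesis using T(1) by blast
  qed
  have "transfer_system G R"
  proof (rule transfer_systemI)
    fix K H assume "(K, H) \<in> R"
    from RE[OF this] show "subgroup K G \<and> subgroup H G \<and> K \<subseteq> H"
      by (auto simp: subgroups_Inter_pair)
  next
    fix H assume H: "subgroup H G"
    show "(H, H) \<in> R"
      by (rule RI[OF T(2)[OF subgroup_self] H]) (simp add: Int_absorb1 subgroup.subset[OF H])
  next
    fix A L g assume "(A, L) \<in> R" and g: "g \<in> carrier G"
    then obtain K where K: "(K, carrier G) \<in> \<O>" "subgroup L G" "subgroup K G" "A = K \<inter> L"
      using RE[of A L] by blast
    show "(g <# A #> inv g, g <# L #> inv g) \<in> R"
    proof (rule RI)
      show "(g <# K #> inv g, carrier G) \<in> \<O>"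
        using T(3)[OF K(1) g] conjugate_carrier[OF g] by simp
      show "subgroup (g <# L #> inv g) G"
        by (rule subgroup_conjugation_is_surj2[OF g K(2)])
      show "g <# A #> inv g = (g <# K #> inv g) \<inter> (g <# L #> inv g)"
        unfolding K(4) using K g by (intro conjugate_Int subgroup.subset)
    qed
  next
    fix A H L assume "(A, H) \<in> R" and L: "subgroup L G" "L \<subseteq> H"
    from RE[OF this(1)] obtain K where K: "(K, carrier G) \<in> \<O>" "A = K \<inter> H"
      by blast
    show "(A \<inter> L, L) \<in> R"
      by (rule RI[OF K(1) L(1)]) (use K(2) L(2) in blast)
  next
    fix L K H assume "(L, K) \<in> R" "(K, H) \<in> R"
    then obtain B C where B: "(B, carrier G) \<in> \<O>" "L = B \<inter> K"
      and C: "(C, carrier G) \<in> \<O>" "subgroup H G" "K = C \<inter> H"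
      using RE[of L K] RE[of K H] by blast
    have "(B \<inter> C, C) \<in> \<O>"
      using T(4)[OF B(1), of C] T(1)[OF C(1)] by simp
    from T(5)[OF this C(1)] have "(B \<inter> C, carrier G) \<in> \<O>" .
    then show "(L, H) \<in> R"
      by (rule RI[OF _ C(2)]) (simp add: B(2) C(3) Int_assoc)
  qed
  moreover have "S \<subseteq> R"
  proof
    fix x assume "x \<in> S"
    then obtain H where x: "x = (H, carrier G)" "subgroup H G" "(H, carrier G) \<in> \<O>"
      using S by blast
    show "x \<in> R"
      unfolding x(1)
      by (rule RI[OF x(3) subgroup_self]) (simp add: Int_absorb2 subgroup.subset[OF x(2)])
  qed
  ultimately have "\<O> \<subseteq> R"
    by (rule least)
  then show "\<forall>A C. (A, C) \<in> \<O> \<longrightarrow> (\<exists>K. (K, carrier G) \<in> \<O> \<and> A = K \<inter> C)"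
    unfolding R_def by blast
  show "transfer_system G \<O>" by fact
next
  assume *: "transfer_system G \<O> \<and>
    (\<forall>A C. (A, C) \<in> \<O> \<longrightarrow> (\<exists>K. (K, carrier G) \<in> \<O> \<and> A = K \<inter> C))"
  note T = transfer_systemD[OF conjunct1[OF *]]
  let ?S = "{(K, carrier G) |K. (K, carrier G) \<in> \<O>}"
  have least: "\<O> \<subseteq> \<T>" if "transfer_system G \<T>" "?S \<subseteq> \<T>" for \<T>
  proof (rule subrelI)
    fix A C assume AC: "(A, C) \<in> \<O>"
    then obtain K where K: "(K, carrier G) \<in> \<O>" "A = K \<inter> C"
      using * by blast
    have C: "subgroup C G"
      using T(1)[OF AC] by blast
    have "(K, carrier G) \<in> \<T>"
      using K(1) that(2) by blast
    from transfer_systemD(4)[OF that(1) this C subgroup.subset[OF C]]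
    show "(A, C) \<in> \<T>" unfolding K(2) .
  qed
  show "disklike G \<O>"
    unfolding disklike_def
  proof (intro exI[of _ ?S] conjI allI impI)
    show "?S \<subseteq> {(H, carrier G) |H. subgroup H G}"
      using T(1) by blast
    show "?S \<subseteq> \<O>" by blast
    show "transfer_system G \<O>" using * by (rule conjunct1)
    show "\<O> \<subseteq> \<T>" if "transfer_system G \<T> \<and> ?S \<subseteq> \<T>" for \<T>
      using least that by blast
  qed
qed

text \<open>
  Each conjugate of the minimal subgroup also transfers to \<open>G\<close>, so it contains the minimal one.
\<close>

lemma (in group) normal_min_transfer:
  assumes "finite (carrier G)" "transfer_system G \<O>"
  shows "min_transfer G \<O> \<lhd> G"
proof -
  let ?N = "min_transfer G \<O>"
  note T = transfer_systemD[OF assms(2)]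
  note min = min_transfer_Least[OF is_group assms]
  have N: "subgroup ?N G"
    using T(1)[OF min(1)] by blast
  have "g \<otimes> h \<otimes> inv g \<in> ?N" if g: "g \<in> carrier G" and h: "h \<in> ?N" for g h
  proof -
    have "(inv g <# ?N #> inv (inv g), carrier G) \<in> \<O>"
      using T(3)[OF min(1), of "inv g"] conjugate_carrier[of "inv g"] g by simp
    then have "h \<in> inv g <# ?N #> inv (inv g)"
      using min(2) h by blast
    then have "g \<otimes> h \<otimes> inv g \<in> g <# (inv g <# ?N #> inv (inv g)) #> inv g"
      unfolding conjugate_eq_image by blast
    then show ?thesis
      using conjugate_inv_cancel(2)[OF g subgroup.subset[OF N]] by simp
  qed
  then show ?thesis
    unfolding normal_inv_iff using N by blast
qed

section \<open>The largest compatible transfer system\<close>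

text \<open>
  The right-hand side is the compatibility condition imposed on all restrictions of \<open>K \<rightarrow> H\<close> at
  once, which any multiplicative transfer satisfies. The condition is inherited by restrictions,
  conjugates and composites, so it defines a transfer system. That system lies in \<open>\<O>\<close> by the case
  \<open>J = K\<close>, \<open>L = H\<close>, and it is compatible by the case \<open>L = H\<close>.
\<close>

lemma (in group) max_multiplicative_eq:
  assumes "transfer_system G \<O>"
  shows "max_multiplicative G \<O> = {(K, H). subgroup K G \<and> subgroup H G \<and> K \<subseteq> H \<and>
    (\<forall>J L. subgroup J G \<and> subgroup L G \<and> J \<subseteq> L \<and> L \<subseteq> H \<and> (K \<inter> J, K \<inter> L) \<in> \<O> \<longrightarrow> (J, L) \<in> \<O>)}"
    (is "_ = ?X")
proof
  note T = transfer_systemD[OF assms]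
  have XI: "(K, H) \<in> ?X" if "subgroup K G" "subgroup H G" "K \<subseteq> H"
    "\<And>J L. subgroup J G \<Longrightarrow> subgroup L G \<Longrightarrow> J \<subseteq> L \<Longrightarrow> L \<subseteq> H \<Longrightarrow> (K \<inter> J, K \<inter> L) \<in> \<O> \<Longrightarrow> (J, L) \<in> \<O>"
    for K H using that by blast
  have X1: "subgroup K G" "subgroup H G" "K \<subseteq> H" if "(K, H) \<in> ?X" for K H
    using that by blast+
  have X2: "(J, L) \<in> \<O>" if "(K, H) \<in> ?X" "subgroup J G" "subgroup L G" "J \<subseteq> L" "L \<subseteq> H"
    "(K \<inter> J, K \<inter> L) \<in> \<O>" for K H J L
    using that by blast
  have "transfer_system G ?X"
  proof (rule transfer_systemI)
    fix K H assume "(K, H) \<in> ?X"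
    then show "subgroup K G \<and> subgroup H G \<and> K \<subseteq> H" by blast
  next
    fix H assume H: "subgroup H G"
    show "(H, H) \<in> ?X"
    proof (rule XI[OF H H order_refl])
      fix J L assume "J \<subseteq> L" "L \<subseteq> H" "(H \<inter> J, H \<inter> L) \<in> \<O>"
      then show "(J, L) \<in> \<O>"
        by (metis Int_absorb1 order_trans)
    qed
  next
    fix K H g assume KH: "(K, H) \<in> ?X" and g: "g \<in> carrier G"
    note KH' = X1[OF KH]
    note sub = subgroup.subset
    let ?c = "\<lambda>A. g <# A #> inv g" and ?d = "\<lambda>A. inv g <# A #> inv (inv g)"
    have g': "inv g \<in> carrier G" using g by simp
    show "(?c K, ?c H) \<in> ?X"
    proof (rule XI)
      show "subgroup (?c K) G" "subgroup (?c H) G" "?c K \<subseteq> ?c H"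
        using KH' g by (simp_all add: subgroup_conjugation_is_surj2 conjugate_mono)
    next
      fix J L assume JL: "subgroup J G" "subgroup L G" "J \<subseteq> L" "L \<subseteq> ?c H"
        "(?c K \<inter> J, ?c K \<inter> L) \<in> \<O>"
      have d: "?d (?c K \<inter> A) = K \<inter> ?d A" if "subgroup A G" for A
        using conjugate_Int[OF g' sub[OF subgroup_conjugation_is_surj2[OF g KH'(1)]] sub[OF that]]
          conjugate_inv_cancel(1)[OF g sub[OF KH'(1)]] by simp
      have "(?d J, ?d L) \<in> \<O>"
      proof (rule X2[OF KH])
        show "subgroup (?d J) G" "subgroup (?d L) G"
          using JL g' by (simp_all add: subgroup_conjugation_is_surj2 del: inv_inv)
        show "?d J \<subseteq> ?d L" by (rule conjugate_mono[OF JL(3)])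
        show "?d L \<subseteq> H"
          using conjugate_mono[OF JL(4), of "inv g"] conjugate_inv_cancel(1)[OF g sub[OF KH'(2)]]
          by simp
        show "(K \<inter> ?d J, K \<inter> ?d L) \<in> \<O>"
          using T(3)[OF JL(5) g'] d JL by simp
      qed
      from T(3)[OF this g] show "(J, L) \<in> \<O>"
        using conjugate_inv_cancel(2)[OF g sub] JL by simp
    qed
  next
    fix K H L assume KH: "(K, H) \<in> ?X" and L: "subgroup L G" "L \<subseteq> H"
    show "(K \<inter> L, L) \<in> ?X"
    proof (rule XI)
      show "subgroup (K \<inter> L) G"
        using X1[OF KH] L by (simp add: subgroups_Inter_pair)
    next
      fix J M assume JM: "subgroup J G" "subgroup M G" "J \<subseteq> M" "M \<subseteq> L"
        "(K \<inter> L \<inter> J, K \<inter> L \<inter> M) \<in> \<O>"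
      have "K \<inter> L \<inter> J = K \<inter> J" "K \<inter> L \<inter> M = K \<inter> M"
        using JM by blast+
      then show "(J, M) \<in> \<O>"
        using X2[OF KH JM(1-3)] JM(4,5) L(2) by auto
    qed (use L in auto)
  next
    fix L K H assume LK: "(L, K) \<in> ?X" and KH: "(K, H) \<in> ?X"
    show "(L, H) \<in> ?X"
    proof (rule XI)
      fix J M assume JM: "subgroup J G" "subgroup M G" "J \<subseteq> M" "M \<subseteq> H" "(L \<inter> J, L \<inter> M) \<in> \<O>"
      \<comment> \<open>Pass from \<open>L\<close> to \<open>K\<close> with the pair \<open>K \<inter> J \<le> K \<inter> M\<close> as test pair for \<open>L \<rightarrow> K\<close>, and from \<open>K\<close>
        to \<open>H\<close> with \<open>J \<le> M\<close>.\<close>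
      have "(K \<inter> J, K \<inter> M) \<in> \<O>"
      proof (rule X2[OF LK])
        have "L \<inter> (K \<inter> J) = L \<inter> J" "L \<inter> (K \<inter> M) = L \<inter> M"
          using X1(3)[OF LK] by blast+
        then show "(L \<inter> (K \<inter> J), L \<inter> (K \<inter> M)) \<in> \<O>"
          using JM(5) by simp
      qed (use JM X1[OF KH] in \<open>auto intro: subgroups_Inter_pair\<close>)
      then show "(J, M) \<in> \<O>"
        by (rule X2[OF KH JM(1-4)])
    qed (use X1[OF LK] X1[OF KH] in auto)
  qed
  moreover have "?X \<subseteq> \<O>"
  proof (rule subrelI)
    fix K H assume KH: "(K, H) \<in> ?X"
    have "(K \<inter> K, K \<inter> H) \<in> \<O>"
      using T(2) X1[OF KH] by (simp add: Int_absorb2)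
    then show "(K, H) \<in> \<O>"
      using X2[OF KH X1[OF KH]] by simp
  qed
  moreover have "(J, H) \<in> \<O>"
    if "(K, H) \<in> ?X" "subgroup J G" "J \<subseteq> H" "(K \<inter> J, K) \<in> \<O>" for K J H
    using X2[OF that(1,2) _ that(3)] X1[OF that(1)] that(4) by (simp add: Int_absorb2)
  ultimately have "compatible G \<O> ?X"
    unfolding compatible_def using assms by blast
  then show "?X \<subseteq> max_multiplicative G \<O>"
    by (rule compatible_max_multiplicative(2)[OF is_group assms])
  show "max_multiplicative G \<O> \<subseteq> ?X"
  proof (rule subrelI)
    fix K H assume KH: "(K, H) \<in> max_multiplicative G \<O>"
    note comp = compatible_max_multiplicative(1)[OF is_group assms, unfolded compatible_def]
    note M = transfer_systemD[OF comp[THEN conjunct2, THEN conjunct1]]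
    note KH' = M(1)[OF KH]
    show "(K, H) \<in> ?X"
    proof (rule XI)
      fix J L assume JL: "subgroup J G" "subgroup L G" "J \<subseteq> L" "L \<subseteq> H" "(K \<inter> J, K \<inter> L) \<in> \<O>"
      have "(K \<inter> L, L) \<in> max_multiplicative G \<O>"
        by (rule M(4)[OF KH JL(2,4)])
      moreover have "K \<inter> L \<inter> J = K \<inter> J" using JL by blast
      moreover have "subgroup (K \<inter> L) G"
        using KH' JL by (simp add: subgroups_Inter_pair)
      ultimately show "(J, L) \<in> \<O>"
        using comp[THEN conjunct2, THEN conjunct2, THEN conjunct2, rule_format, of "K \<inter> L" J L] JL
        by simp
    qed (use KH' in auto)
  qed
qed

corollary (in group) max_multiplicative_iff:
  assumes "transfer_system G \<O>"
  shows "(K, H) \<in> max_multiplicative G \<O> \<longleftrightarrow> subgroup K G \<and> subgroup H G \<and> K \<subseteq> H \<and>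
    (\<forall>J L. subgroup J G \<and> subgroup L G \<and> J \<subseteq> L \<and> L \<subseteq> H \<and> (K \<inter> J, K \<inter> L) \<in> \<O> \<longrightarrow> (J, L) \<in> \<O>)"
  unfolding max_multiplicative_eq[OF assms] mem_Collect_eq prod.case ..

section \<open>Transfer systems along a surjective homomorphism\<close>

locale surjective_group_hom = group_hom G Q p
  for G :: "('a, 'b) monoid_scheme" (structure) and Q :: "('c, 'd) monoid_scheme" (structure) and p +
  assumes surj: "p ` carrier G = carrier Q"
begin

abbreviation N :: "'a set" where "N \<equiv> kernel G Q p"

abbreviation pre :: "'c set \<Rightarrow> 'a set" where "pre K \<equiv> {x \<in> carrier G. p x \<in> K}"

lemma subgroup_pre: "subgroup K Q \<Longrightarrow> subgroup (pre K) G"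
  by (rule subgroup.intro) (auto simp: subgroup.m_closed subgroup.one_closed subgroup.m_inv_closed)

lemma kernel_subset_pre: "subgroup K Q \<Longrightarrow> N \<subseteq> pre K"
  by (auto simp: kernel_def subgroup.one_closed)

lemma image_pre: "K \<subseteq> carrier Q \<Longrightarrow> p ` pre K = K"
  unfolding surj[symmetric] by blast

text \<open>
  If \<open>C \<inter> N \<subseteq> A\<close>, then \<open>A\<close> is saturated inside \<open>C\<close>: two elements of \<open>C\<close> in the same fibre of \<open>p\<close>
  differ by an element of \<open>C \<inter> N\<close>.
\<close>

lemma mem_if_image_mem:
  assumes "subgroup A G" "subgroup C G" "A \<subseteq> C" "C \<inter> N \<subseteq> A" "x \<in> C" "p x \<in> p ` A"
  shows "x \<in> A"
proof -
  obtain a where a: "p x = p a" "a \<in> A"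
    using assms(6) by (rule imageE)
  have car: "a \<in> carrier G" "x \<in> carrier G"
    using subgroup.mem_carrier[OF assms(1) a(2)] subgroup.mem_carrier[OF assms(2,5)] .
  have "p (x \<otimes>\<^bsub>G\<^esub> inv\<^bsub>G\<^esub> a) = \<one>\<^bsub>Q\<^esub>"
    using a car by simp
  moreover have "x \<otimes>\<^bsub>G\<^esub> inv\<^bsub>G\<^esub> a \<in> C"
    using a(2) assms(3,5) by (intro subgroup.m_closed subgroup.m_inv_closed assms(2)) blast+
  ultimately have "x \<otimes>\<^bsub>G\<^esub> inv\<^bsub>G\<^esub> a \<in> A"
    using assms(4) car by (auto simp: kernel_def)
  then have "x \<otimes>\<^bsub>G\<^esub> inv\<^bsub>G\<^esub> a \<otimes>\<^bsub>G\<^esub> a \<in> A"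
    by (rule subgroup.m_closed[OF assms(1) _ a(2)])
  then show ?thesis
    using car by (simp add: G.m_assoc)
qed

lemma pre_image:
  assumes "subgroup A G" "N \<subseteq> A"
  shows "pre (p ` A) = A"
proof
  show "A \<subseteq> pre (p ` A)"
    using subgroup.mem_carrier[OF assms(1)] by (simp add: subset_iff)
  show "pre (p ` A) \<subseteq> A"
  proof
    fix x assume "x \<in> pre (p ` A)"
    then have x: "x \<in> carrier G" "p x \<in> p ` A" by simp_all
    show "x \<in> A"
      by (rule mem_if_image_mem[OF assms(1) G.subgroup_self subgroup.subset[OF assms(1)] _ x])
        (use assms(2) in blast)
  qed
qed

lemma image_Int_subgroup:
  assumes "subgroup A G" "subgroup C G" "A \<subseteq> C" "C \<inter> N \<subseteq> A" "L \<subseteq> C"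
  shows "p ` (A \<inter> L) = p ` A \<inter> p ` L"
proof
  show "p ` A \<inter> p ` L \<subseteq> p ` (A \<inter> L)"
  proof
    fix y assume "y \<in> p ` A \<inter> p ` L"
    then have "y \<in> p ` L" "y \<in> p ` A" by simp_all
    then obtain x where x: "y = p x" "x \<in> L" by (elim imageE)
    have "x \<in> A"
    proof (rule mem_if_image_mem[OF assms(1-4)])
      show "x \<in> C" using x(2) assms(5) by (rule subsetD[rotated])
      show "p x \<in> p ` A" using \<open>y \<in> p ` A\<close> unfolding x(1) .
    qed
    then show "y \<in> p ` (A \<inter> L)" using x by simp
  qed
qed (rule image_Int_subset)

lemma image_conjugate:
  assumes "A \<subseteq> carrier G" "g \<in> carrier G"
  shows "p ` (g <#\<^bsub>G\<^esub> A #>\<^bsub>G\<^esub> inv\<^bsub>G\<^esub> g) = p g <#\<^bsub>Q\<^esub> p ` A #>\<^bsub>Q\<^esub> inv\<^bsub>Q\<^esub> p g"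
  unfolding G.conjugate_eq_image H.conjugate_eq_image image_image
  using assms by (intro image_cong) auto

text \<open>
  Restricting \<open>p\<^sup>-\<^sup>1 K \<rightarrow> p\<^sup>-\<^sup>1 H\<close> to \<open>C\<close> gives \<open>A = C \<inter> p\<^sup>-\<^sup>1 K\<close>, so that \<open>p A = K \<inter> p C\<close> and
  \<open>p A \<rightarrow> p C\<close> is itself a restriction of \<open>K \<rightarrow> H\<close>. Conversely, saturation gives
  \<open>A = C \<inter> p\<^sup>-\<^sup>1 (p A)\<close>.
\<close>

lemma Res_preimage_iff:
  assumes "transfer_system Q \<P>"
  shows "(A, C) \<in> Res G (preimage_system G p \<P>) \<longleftrightarrow>
    subgroup A G \<and> subgroup C G \<and> A \<subseteq> C \<and> C \<inter> N \<subseteq> A \<and> (p ` A, p ` C) \<in> \<P>"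
proof
  note T = transfer_systemD[OF assms]
  assume "(A, C) \<in> Res G (preimage_system G p \<P>)"
  then obtain X Y where XY: "(X, Y) \<in> preimage_system G p \<P>"
    and C: "subgroup C G" "C \<subseteq> Y" and A: "A = C \<inter> X"
    unfolding Res_def by blast
  from XY obtain K H where KH: "(K, H) \<in> \<P>" "X = pre K" "Y = pre H"
    unfolding preimage_system_def by blast
  have K: "subgroup K Q"
    using T(1)[OF KH(1)] by simp
  have pC: "p ` C \<subseteq> H"
    using C(2) unfolding KH(3) by auto
  have A_iff: "x \<in> A \<longleftrightarrow> x \<in> C \<and> p x \<in> K" for x
    unfolding A KH(2) using subgroup.mem_carrier[OF C(1), of x] by auto
  have pA: "p ` A = K \<inter> p ` C"
  proof (intro equalityI subsetI)
    fix y assume "y \<in> p ` A"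
    then obtain x where "y = p x" "x \<in> A" by (rule imageE)
    then show "y \<in> K \<inter> p ` C" by (simp add: A_iff)
  next
    fix y assume "y \<in> K \<inter> p ` C"
    then have "y \<in> p ` C" "y \<in> K" by simp_all
    then obtain x where "y = p x" "x \<in> C" by (elim imageE)
    then have "x \<in> A" using \<open>y \<in> K\<close> by (simp add: A_iff)
    then show "y \<in> p ` A" using \<open>y = p x\<close> by simp
  qed
  have "(K \<inter> p ` C, p ` C) \<in> \<P>"
    by (rule T(4)[OF KH(1) subgroup_img_is_subgroup[OF C(1)] pC])
  moreover have "subgroup A G"
    unfolding A KH(2) by (rule G.subgroups_Inter_pair[OF C(1) subgroup_pre[OF K]])
  moreover have "C \<inter> N \<subseteq> A"
    unfolding A KH(2) using kernel_subset_pre[OF K] by blast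
  ultimately show "subgroup A G \<and> subgroup C G \<and> A \<subseteq> C \<and> C \<inter> N \<subseteq> A \<and> (p ` A, p ` C) \<in> \<P>"
    using C(1) A unfolding pA by simp
next
  assume *: "subgroup A G \<and> subgroup C G \<and> A \<subseteq> C \<and> C \<inter> N \<subseteq> A \<and> (p ` A, p ` C) \<in> \<P>"
  then have sub: "A \<subseteq> carrier G" "C \<subseteq> carrier G"
    by (simp_all add: subgroup.subset)
  have "A = C \<inter> pre (p ` A)"
  proof
    show "A \<subseteq> C \<inter> pre (p ` A)"
      using * sub(1) by auto
    show "C \<inter> pre (p ` A) \<subseteq> A"
    proof
      fix x assume x: "x \<in> C \<inter> pre (p ` A)"
      show "x \<in> A"
        by (rule mem_if_image_mem[of A C]) (use * x in simp_all)
    qed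
  qed
  moreover have "C \<subseteq> pre (p ` C)"
    using sub(2) by auto
  moreover have "(p ` A, p ` C) \<in> \<P>"
    using * by simp
  then have "(pre (p ` A), pre (p ` C)) \<in> preimage_system G p \<P>"
    unfolding preimage_system_def by blast
  moreover have "subgroup C G"
    using * by simp
  ultimately show "(A, C) \<in> Res G (preimage_system G p \<P>)"
    unfolding Res_def by blast
qed

lemma transfer_system_Res_preimage:
  assumes "transfer_system Q \<P>"
  shows "transfer_system G (Res G (preimage_system G p \<P>))" (is "transfer_system G ?R")
proof (rule transfer_systemI)
  note T = transfer_systemD[OF assms]
  note iff = Res_preimage_iff[OF assms]
  {
    fix K H assume "(K, H) \<in> ?R"
    then show "subgroup K G \<and> subgroup H G \<and> K \<subseteq> H"
      unfolding iff by simp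
  next
    fix H assume "subgroup H G"
    then show "(H, H) \<in> ?R"
      unfolding iff by (simp add: T(2) subgroup_img_is_subgroup)
  next
    fix A C g assume AC: "(A, C) \<in> ?R" and g: "g \<in> carrier G"
    let ?c = "\<lambda>A. g <#\<^bsub>G\<^esub> A #>\<^bsub>G\<^esub> inv\<^bsub>G\<^esub> g"
    note AC' = AC[unfolded iff]
    have sub: "A \<subseteq> carrier G" "C \<subseteq> carrier G"
      using AC' by (simp_all add: subgroup.subset)
    have "?c C \<inter> N \<subseteq> ?c A"
    proof
      fix x assume x: "x \<in> ?c C \<inter> N"
      then obtain y where y: "y \<in> C" "x = g \<otimes>\<^bsub>G\<^esub> y \<otimes>\<^bsub>G\<^esub> inv\<^bsub>G\<^esub> g"
        unfolding G.conjugate_eq_image by blast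
      have "inv\<^bsub>G\<^esub> g \<otimes>\<^bsub>G\<^esub> x \<otimes>\<^bsub>G\<^esub> g \<in> N"
        by (rule normal.inv_op_closed1[OF normal_kernel g]) (use x in blast)
      moreover have "inv\<^bsub>G\<^esub> g \<otimes>\<^bsub>G\<^esub> x \<otimes>\<^bsub>G\<^esub> g = y"
        using G.conjugation_is_surj[of "inv\<^bsub>G\<^esub> g" y] subsetD[OF sub(2) y(1)] g
        unfolding y(2) by simp
      ultimately have "y \<in> C \<inter> N"
        using y(1) by simp
      then have "y \<in> A"
        using AC' by blast
      then show "x \<in> ?c A"
        unfolding G.conjugate_eq_image y(2) by blast
    qed
    then show "(?c A, ?c C) \<in> ?R"
      unfolding iff image_conjugate[OF sub(1) g] image_conjugate[OF sub(2) g]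
      using AC' g T(3) by (simp add: G.subgroup_conjugation_is_surj2 G.conjugate_mono)
  next
    fix A C L assume AC: "(A, C) \<in> ?R" and L: "subgroup L G" "L \<subseteq> C"
    note AC' = AC[unfolded iff]
    have "p ` (A \<inter> L) = p ` A \<inter> p ` L"
      by (rule image_Int_subgroup[of A C]) (simp_all add: AC' L(2))
    moreover have "(p ` A \<inter> p ` L, p ` L) \<in> \<P>"
      by (rule T(4)[of "p ` A" "p ` C"])
        (simp_all add: AC' L subgroup_img_is_subgroup image_mono)
    moreover have "L \<inter> N \<subseteq> A \<inter> L"
      using AC' L(2) by blast
    ultimately show "(A \<inter> L, L) \<in> ?R"
      unfolding iff using AC' L by (simp add: G.subgroups_Inter_pair)
  next
    fix A B C assume AB: "(A, B) \<in> ?R" and BC: "(B, C) \<in> ?R"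
    note AB' = AB[unfolded iff] and BC' = BC[unfolded iff]
    have "(p ` A, p ` C) \<in> \<P>"
      using AB' BC' T(5)[of "p ` A" "p ` B" "p ` C"] by simp
    moreover have "A \<subseteq> C" "C \<inter> N \<subseteq> A"
      using AB' BC' by blast+
    ultimately show "(A, C) \<in> ?R"
      unfolding iff using AB' BC' by simp
  }
qed

text \<open>
  The pairs \<open>J \<le> L\<close> that test \<open>A \<rightarrow> C\<close> upstairs and \<open>p A \<rightarrow> p C\<close> downstairs are matched by taking
  \<open>C \<inter> p\<^sup>-\<^sup>1 J\<close> in one direction and images in the other. Upstairs the extra condition
  \<open>L \<inter> N \<subseteq> J\<close> has to be supplied: it follows from \<open>A \<inter> L \<inter> N \<subseteq> A \<inter> J\<close>, because
  \<open>L \<inter> N \<subseteq> C \<inter> N \<subseteq> A\<close>.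
\<close>

theorem max_multiplicative_Res_preimage:
  assumes P: "transfer_system Q \<P>"
  shows "max_multiplicative G (Res G (preimage_system G p \<P>)) =
    Res G (preimage_system G p (max_multiplicative Q \<P>))"
proof -
  let ?O = "Res G (preimage_system G p \<P>)"
  have ts: "transfer_system Q (max_multiplicative Q \<P>)"
    by (rule compatible_max_multiplicative(1)[OF H.is_group P, unfolded compatible_def,
          THEN conjunct2, THEN conjunct1])
  note O_iff = Res_preimage_iff[OF P]
  note MG = G.max_multiplicative_iff[OF transfer_system_Res_preimage[OF P]]
  note MQ = H.max_multiplicative_iff[OF P]
  have MG_D: "(J, L) \<in> ?O" if "(K, H) \<in> max_multiplicative G ?O" "subgroup J G" "subgroup L G"
    "J \<subseteq> L" "L \<subseteq> H" "(K \<inter> J, K \<inter> L) \<in> ?O" for K H J L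
    by (rule MG[THEN iffD1, OF that(1), THEN conjunct2, THEN conjunct2, THEN conjunct2, rule_format])
      (intro conjI that(2-))
  have MQ_D: "(J, L) \<in> \<P>" if "(K, H) \<in> max_multiplicative Q \<P>" "subgroup J Q" "subgroup L Q"
    "J \<subseteq> L" "L \<subseteq> H" "(K \<inter> J, K \<inter> L) \<in> \<P>" for K H J L
    by (rule MQ[THEN iffD1, OF that(1), THEN conjunct2, THEN conjunct2, THEN conjunct2, rule_format])
      (intro conjI that(2-))
  show ?thesis
  proof (intro equalityI subrelI)
    fix A C assume AC: "(A, C) \<in> max_multiplicative G ?O"
    have sub: "subgroup A G" "subgroup C G" "A \<subseteq> C"
      using AC unfolding MG by blast+
    have "(A, C) \<in> ?O"
      by (rule subsetD[OF compatible_max_multiplicative(1)[OF G.is_group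
              transfer_system_Res_preimage[OF P], unfolded compatible_def, THEN conjunct2,
              THEN conjunct2, THEN conjunct1] AC])
    then have N: "C \<inter> N \<subseteq> A"
      unfolding O_iff by simp
    have *: "(J, L) \<in> \<P>" if JL: "subgroup J Q" "subgroup L Q" "J \<subseteq> L" "L \<subseteq> p ` C"
      "(p ` A \<inter> J, p ` A \<inter> L) \<in> \<P>" for J L
    proof -
      have lift: "p ` (B \<inter> pre M) = p ` B \<inter> M" if "subgroup B G" for B M
        using subgroup.subset[OF that] by auto
      have pC: "p ` C \<inter> J = J" "p ` C \<inter> L = L"
        using JL(3,4) by blast+
      have A: "A \<inter> (C \<inter> pre M) = A \<inter> pre M" for M
        using sub(3) by blast
      have pre: "subgroup (pre J) G" "subgroup (pre L) G" "N \<subseteq> pre J"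
        using JL(1,2) by (simp_all add: subgroup_pre kernel_subset_pre)
      have "(C \<inter> pre J, C \<inter> pre L) \<in> ?O"
      proof (rule MG_D[OF AC])
        show "subgroup (C \<inter> pre J) G" "subgroup (C \<inter> pre L) G"
          using pre sub by (simp_all add: G.subgroups_Inter_pair)
        show "C \<inter> pre J \<subseteq> C \<inter> pre L" "C \<inter> pre L \<subseteq> C"
          using JL(3) by blast+
        have "subgroup (A \<inter> pre J) G" "subgroup (A \<inter> pre L) G"
          using pre sub by (simp_all add: G.subgroups_Inter_pair)
        moreover have "A \<inter> pre J \<subseteq> A \<inter> pre L" "A \<inter> pre L \<inter> N \<subseteq> A \<inter> pre J"
          using JL(3) pre(3) by blast+
        ultimately show "(A \<inter> (C \<inter> pre J), A \<inter> (C \<inter> pre L)) \<in> ?O"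
          unfolding O_iff A lift[OF sub(1)] using JL(5) by simp
      qed
      then show ?thesis
        unfolding O_iff lift[OF sub(2)] pC by simp
    qed
    have "(p ` A, p ` C) \<in> max_multiplicative Q \<P>"
      unfolding MQ
      by (intro conjI allI impI subgroup_img_is_subgroup image_mono sub) (rule *; simp)
    then show "(A, C) \<in> Res G (preimage_system G p (max_multiplicative Q \<P>))"
      unfolding Res_preimage_iff[OF ts] using sub N by simp
  next
    fix A C assume "(A, C) \<in> Res G (preimage_system G p (max_multiplicative Q \<P>))"
    then have sub: "subgroup A G" "subgroup C G" "A \<subseteq> C" and N: "C \<inter> N \<subseteq> A"
      and M: "(p ` A, p ` C) \<in> max_multiplicative Q \<P>"
      unfolding Res_preimage_iff[OF ts] by simp_all
    have *: "(J, L) \<in> ?O" if JL: "subgroup J G" "subgroup L G" "J \<subseteq> L" "L \<subseteq> C"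
      "(A \<inter> J, A \<inter> L) \<in> ?O" for J L
    proof -
      have "p ` (A \<inter> J) = p ` A \<inter> p ` J" "p ` (A \<inter> L) = p ` A \<inter> p ` L"
        using image_Int_subgroup[OF sub N, of J] image_Int_subgroup[OF sub N, of L] JL(3,4)
        by simp_all
      moreover have "(p ` (A \<inter> J), p ` (A \<inter> L)) \<in> \<P>" and AL: "A \<inter> L \<inter> N \<subseteq> A \<inter> J"
        using JL(5) unfolding O_iff by simp_all
      ultimately have "(p ` J, p ` L) \<in> \<P>"
        using JL by (intro MQ_D[OF M, of "p ` J" "p ` L"] subgroup_img_is_subgroup image_mono) simp_all
      moreover have "L \<inter> N \<subseteq> J"
        using AL N JL(4) by blast
      ultimately show ?thesis
        unfolding O_iff using JL by simp
    qed
    show "(A, C) \<in> max_multiplicative G ?O"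
      unfolding MG by (intro conjI allI impI sub) (rule *; simp)
  qed
qed

section \<open>The quotient of a transfer system\<close>

text \<open>
  For the projection \<open>G \<rightarrow> G/N\<close> this is the system \<open>\<O>\<^sup>N\<close>; the condition \<open>N \<subseteq> H\<close> makes \<open>H\<close>
  recoverable from its image.
\<close>

definition image_system :: "('a set \<times> 'a set) set \<Rightarrow> ('c set \<times> 'c set) set" where
  "image_system \<O> = {(p ` H, p ` K) |H K. (H, K) \<in> \<O> \<and> N \<subseteq> H \<and> N \<subseteq> K}"

lemma image_systemI:
  "(H, K) \<in> \<O> \<Longrightarrow> N \<subseteq> H \<Longrightarrow> N \<subseteq> K \<Longrightarrow> (p ` H, p ` K) \<in> image_system \<O>"
  unfolding image_system_def by blast

lemma image_system_iff:
  assumes "transfer_system G \<O>"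
  shows "(A, C) \<in> image_system \<O> \<longleftrightarrow> subgroup A Q \<and> subgroup C Q \<and> (pre A, pre C) \<in> \<O>"
proof
  assume "(A, C) \<in> image_system \<O>"
  then obtain H K where HK: "(H, K) \<in> \<O>" "N \<subseteq> H" "N \<subseteq> K" "A = p ` H" "C = p ` K"
    unfolding image_system_def by blast
  have "subgroup H G" "subgroup K G"
    using transfer_systemD(1)[OF assms HK(1)] by simp_all
  then show "subgroup A Q \<and> subgroup C Q \<and> (pre A, pre C) \<in> \<O>"
    unfolding HK(4,5) using HK(1-3) by (simp add: pre_image subgroup_img_is_subgroup)
next
  assume *: "subgroup A Q \<and> subgroup C Q \<and> (pre A, pre C) \<in> \<O>"
  have "p ` pre A = A" "p ` pre C = C"
    using * by (simp_all add: image_pre subgroup.subset)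
  moreover have "N \<subseteq> pre A" "N \<subseteq> pre C"
    using * by (simp_all add: kernel_subset_pre)
  moreover have "(p ` pre A, p ` pre C) \<in> image_system \<O>"
    by (rule image_systemI) (simp_all add: * calculation(3,4))
  ultimately show "(A, C) \<in> image_system \<O>"
    by simp
qed

lemma transfer_system_image_system:
  assumes "transfer_system G \<O>"
  shows "transfer_system Q (image_system \<O>)"
proof (rule transfer_systemI)
  note T = transfer_systemD[OF assms]
  note iff = image_system_iff[OF assms]
  {
    fix A C assume "(A, C) \<in> image_system \<O>"
    then have AC: "subgroup A Q" "subgroup C Q" "(pre A, pre C) \<in> \<O>"
      unfolding iff by simp_all
    have "p ` pre A \<subseteq> p ` pre C"
      using T(1)[OF AC(3)] by (intro image_mono) simp
    then show "subgroup A Q \<and> subgroup C Q \<and> A \<subseteq> C"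
      using AC by (simp add: image_pre subgroup.subset)
  next
    fix C assume "subgroup C Q"
    then show "(C, C) \<in> image_system \<O>"
      unfolding iff using T(2) subgroup_pre by simp
  next
    fix A C q assume "(A, C) \<in> image_system \<O>" and q: "q \<in> carrier Q"
    then obtain H K where HK: "(H, K) \<in> \<O>" "N \<subseteq> H" "N \<subseteq> K" "A = p ` H" "C = p ` K"
      unfolding image_system_def by blast
    obtain g where g: "g \<in> carrier G" "q = p g"
      using q surj by blast
    have sub: "H \<subseteq> carrier G" "K \<subseteq> carrier G"
      using T(1)[OF HK(1)] by (simp_all add: subgroup.subset)
    have N: "N \<subseteq> g <#\<^bsub>G\<^esub> B #>\<^bsub>G\<^esub> inv\<^bsub>G\<^esub> g" if "N \<subseteq> B" for B
    proof
      fix x assume x: "x \<in> N"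
      have "inv\<^bsub>G\<^esub> g \<otimes>\<^bsub>G\<^esub> x \<otimes>\<^bsub>G\<^esub> g \<in> B"
        using normal.inv_op_closed1[OF normal_kernel g(1) x] that by blast
      moreover have "x \<in> carrier G"
        using x by (simp add: kernel_def)
      ultimately show "x \<in> g <#\<^bsub>G\<^esub> B #>\<^bsub>G\<^esub> inv\<^bsub>G\<^esub> g"
        unfolding G.conjugate_eq_image using G.conjugation_is_surj[OF g(1)]
        by (intro image_eqI) simp_all
    qed
    show "(q <#\<^bsub>Q\<^esub> A #>\<^bsub>Q\<^esub> inv\<^bsub>Q\<^esub> q, q <#\<^bsub>Q\<^esub> C #>\<^bsub>Q\<^esub> inv\<^bsub>Q\<^esub> q) \<in> image_system \<O>"
      unfolding HK(4,5) g(2) image_conjugate[OF sub(1) g(1), symmetric]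
        image_conjugate[OF sub(2) g(1), symmetric]
      by (rule image_systemI[OF T(3)[OF HK(1) g(1)] N[OF HK(2)] N[OF HK(3)]])
  next
    fix A C L assume "(A, C) \<in> image_system \<O>" and L: "subgroup L Q" "L \<subseteq> C"
    then have AC: "subgroup A Q" "subgroup C Q" "(pre A, pre C) \<in> \<O>"
      unfolding iff by simp_all
    have "pre L \<subseteq> pre C" using L(2) by blast
    from T(4)[OF AC(3) subgroup_pre[OF L(1)] this]
    have "(pre A \<inter> pre L, pre L) \<in> \<O>" .
    moreover have "pre A \<inter> pre L = pre (A \<inter> L)" by blast
    ultimately show "(A \<inter> L, L) \<in> image_system \<O>"
      unfolding iff using AC(1) L(1) by (simp add: H.subgroups_Inter_pair)
  next
    fix A B C assume "(A, B) \<in> image_system \<O>" "(B, C) \<in> image_system \<O>"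
    then show "(A, C) \<in> image_system \<O>"
      unfolding iff using T(5) by blast
  }
qed

text \<open>
  A transfer that restricts \<open>K \<rightarrow> G\<close> has as image a restriction of \<open>p K \<rightarrow> Q\<close>; the latter lies in
  the image system because \<open>K\<close> contains the kernel.
\<close>

lemma disklike_image_system:
  assumes "disklike G \<O>" and N: "\<And>K. (K, carrier G) \<in> \<O> \<Longrightarrow> N \<subseteq> K"
  shows "disklike Q (image_system \<O>)"
  unfolding H.disklike_iff
proof (intro conjI allI impI)
  have ts: "transfer_system G \<O>"
    using assms(1) unfolding G.disklike_iff by (rule conjunct1)
  show "transfer_system Q (image_system \<O>)"
    by (rule transfer_system_image_system[OF ts])
  fix A C assume "(A, C) \<in> image_system \<O>"
  then have AC: "subgroup A Q" "subgroup C Q" "(pre A, pre C) \<in> \<O>"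
    unfolding image_system_iff[OF ts] by simp_all
  obtain K where K: "(K, carrier G) \<in> \<O>" "pre A = K \<inter> pre C"
    using conjunct2[OF assms(1)[unfolded G.disklike_iff], rule_format, OF AC(3)] by (elim exE conjE)
  have "(p ` K, p ` carrier G) \<in> image_system \<O>"
    by (rule image_systemI[OF K(1) N[OF K(1)] subgroup.subset[OF subgroup_kernel]])
  moreover have "A = p ` K \<inter> C"
  proof -
    have "p ` (K \<inter> pre C) = p ` K \<inter> C"
      using transfer_systemD(1)[OF ts K(1)] by auto
    then show ?thesis
      using image_pre[OF subgroup.subset[OF AC(1)]] K(2) by simp
  qed
  ultimately show "\<exists>K. (K, carrier Q) \<in> image_system \<O> \<and> A = K \<inter> C"
    unfolding surj by (intro exI conjI)
qed

text \<open>
  The only information lost on passing to images is what happens inside \<open>N\<close>. A restriction of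
  \<open>K \<rightarrow> G\<close> with \<open>N \<subseteq> K\<close> carries none, since it contains the whole of \<open>C \<inter> N\<close>.
\<close>

lemma Res_preimage_image_system:
  assumes "disklike G \<O>" and N: "\<And>K. (K, carrier G) \<in> \<O> \<Longrightarrow> N \<subseteq> K"
  shows "Res G (preimage_system G p (image_system \<O>)) = \<O>"
proof -
  have ts: "transfer_system G \<O>"
    using assms(1) unfolding G.disklike_iff by (rule conjunct1)
  note T = transfer_systemD[OF ts]
  note iff = Res_preimage_iff[OF transfer_system_image_system[OF ts]]
  show ?thesis
  proof (intro equalityI subrelI)
    fix A C assume "(A, C) \<in> Res G (preimage_system G p (image_system \<O>))"
    then have AC: "subgroup A G" "subgroup C G" "A \<subseteq> C" "C \<inter> N \<subseteq> A"
      and "(p ` A, p ` C) \<in> image_system \<O>"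
      unfolding iff by simp_all
    then have "(pre (p ` A), pre (p ` C)) \<in> \<O>"
      unfolding image_system_iff[OF ts] by simp
    moreover have "C \<subseteq> pre (p ` C)"
      using subgroup.subset[OF AC(2)] by blast
    ultimately have "(pre (p ` A) \<inter> C, C) \<in> \<O>"
      using T(4) AC(2) by simp
    moreover have "pre (p ` A) \<inter> C = A"
    proof
      show "pre (p ` A) \<inter> C \<subseteq> A"
      proof
        fix x assume "x \<in> pre (p ` A) \<inter> C"
        then have "x \<in> C" "p x \<in> p ` A" by simp_all
        then show "x \<in> A" by (rule mem_if_image_mem[OF AC])
      qed
      show "A \<subseteq> pre (p ` A) \<inter> C"
        using AC(3) subgroup.subset[OF AC(1)] by auto
    qed
    ultimately show "(A, C) \<in> \<O>" by simp
  next
    fix A C assume AC: "(A, C) \<in> \<O>"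
    from conjunct2[OF assms(1)[unfolded G.disklike_iff], rule_format, OF this]
    obtain K where K: "(K, carrier G) \<in> \<O>" "A = K \<inter> C"
      by (elim exE conjE)
    note AC' = T(1)[OF AC] and K' = T(1)[OF K(1)]
    have ts': "transfer_system Q (image_system \<O>)"
      by (rule transfer_system_image_system[OF ts])
    have "(p ` K, p ` carrier G) \<in> image_system \<O>"
      by (rule image_systemI[OF K(1) N[OF K(1)] subgroup.subset[OF subgroup_kernel]])
    then have "(p ` K \<inter> p ` C, p ` C) \<in> image_system \<O>"
      by (rule transfer_systemD(4)[OF ts'])
        (simp_all add: AC' subgroup_img_is_subgroup image_mono subgroup.subset)
    moreover have "p ` A = p ` K \<inter> p ` C"
      unfolding K(2) using N[OF K(1)]
      by (intro image_Int_subgroup[of K "carrier G"])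
        (simp_all add: K' AC' subgroup.subset G.subgroup_self le_infI2)
    moreover have "C \<inter> N \<subseteq> A"
      unfolding K(2) using N[OF K(1)] by blast
    ultimately show "(A, C) \<in> Res G (preimage_system G p (image_system \<O>))"
      unfolding iff using AC' by simp
  qed
qed

end

theorem corollary1p3:
  fixes G :: "('a, 'b) monoid_scheme"
    and \<O> :: "('a set \<times> 'a set) set"
    and N :: "'a set"
    and Q :: "'a set monoid"
    and p :: "'a \<Rightarrow> 'a set"
    and \<O>' :: "('a set set \<times> 'a set set) set"
  assumes "group G"
    and "finite (carrier G)"
    and "disklike G \<O>"
    and "N = min_transfer G \<O>"
    and "Q = G Mod N"
    and "p = quotient_map G N"
    and "\<O>' = quotient_system G N \<O>"
  shows "N \<lhd> G \<and>
         transfer_system Q \<O>' \<and>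
         disklike Q \<O>' \<and>
         ({\<one>\<^bsub>Q\<^esub>}, carrier Q) \<in> \<O>' \<and>
         max_multiplicative G \<O> = Res G (preimage_system G p (max_multiplicative Q \<O>'))"
proof -
  interpret G: group G by fact
  have ts: "transfer_system G \<O>"
    using assms(3) unfolding G.disklike_iff by (rule conjunct1)
  note min = min_transfer_Least[OF assms(1,2) ts, folded assms(4)]
  have N: "N \<lhd> G"
    unfolding assms(4) by (rule G.normal_min_transfer[OF assms(2) ts])
  interpret N: normal N G by (rule N)
  interpret Q: group Q
    unfolding assms(5) by (rule N.factorgroup_is_group)
  interpret surjective_group_hom G Q p
  proof
    show "p \<in> hom G Q"
      unfolding assms(5,6) quotient_map_def by (rule N.r_coset_hom_Mod)
    show "p ` carrier G = carrier Q"
      unfolding assms(5,6) quotient_map_def by (rule carrier_FactGroup[symmetric])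
  qed
  have kernel: "kernel G Q p = N"
  proof (intro equalityI subsetI)
    fix x assume "x \<in> kernel G Q p"
    then have "x \<in> carrier G" "N #>\<^bsub>G\<^esub> x = N"
      unfolding kernel_def assms(5,6) quotient_map_def one_FactGroup by simp_all
    then show "x \<in> N"
      using G.coset_join1[OF _ _ N.subgroup_axioms] by blast
  next
    fix x assume x: "x \<in> N"
    then show "x \<in> kernel G Q p"
      unfolding kernel_def assms(5,6) quotient_map_def one_FactGroup
      using G.coset_join2[OF _ N.subgroup_axioms x] by simp
  qed
  have O': "\<O>' = image_system \<O>"
    by (simp add: assms(7) quotient_system_def image_system_def kernel flip: assms(6))
  have ker_min: "kernel G Q p \<subseteq> K" if "(K, carrier G) \<in> \<O>" for K
    unfolding kernel by (rule min(2)[OF that])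
  have ts': "transfer_system Q \<O>'"
    unfolding O' by (rule transfer_system_image_system[OF ts])
  have "disklike Q \<O>'"
    unfolding O' by (rule disklike_image_system[OF assms(3) ker_min])
  moreover have "({\<one>\<^bsub>Q\<^esub>}, carrier Q) \<in> \<O>'"
  proof -
    have "p ` N = {\<one>\<^bsub>Q\<^esub>}"
      using N.one_closed unfolding kernel[symmetric] by (auto simp: kernel_def)
    moreover have "(p ` N, p ` carrier G) \<in> \<O>'"
      unfolding O' by (rule image_systemI) (simp_all add: kernel min(1) N.subset)
    ultimately show ?thesis
      unfolding surj by simp
  qed
  moreover have "max_multiplicative G \<O> = Res G (preimage_system G p (max_multiplicative Q \<O>'))"
    using max_multiplicative_Res_preimage[OF ts'] Res_preimage_image_system[OF assms(3) ker_min]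
    unfolding O' by simp
  ultimately show ?thesis
    using N ts' by blast
qed

end
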